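(* Every piecewise monotone, locally eventually onto map $f\colon I\to I$ is long-zigzag.
   Context: $I=[0,1]$, $\mathbb{N}=\{1,2,\dots\}$, $\mathbb{N}_0=\mathbb{N}\cup\{0\}$. A map $f\colon I\to I$ always means a continuous surjection; $f^n$ is the $n$-th iterate ($f^0=\mathrm{id}$). A point $c\in(0,1)$ is a critical point of $f$ if for every open $J\ni c$ the restriction $f|_J$ is not one-to-one. $f$ is piecewise monotone if it has finitely many critical points. $f$ is locally eventually onto if for every nondegenerate interval $[a,b]\subset I$ there exists $n\in\mathbb{N}$ such that $f^n([a,b])=I$. Long-zigzag: $f\colon I\to I$ is long-zigzag if there exists $\varepsilon>0$ such that for every $n\in\mathbb{N}_0$ and every interval $[a,b]\subset I$ such that $f^n([a,b])=[f^n(a),f^n(b)]$ or $f^n([a,b])=[f^n(b),f^n(a)]$, $f^n(x)\notin\{f^n(a),f^n(b)\}$ for every $x\in(a,b)$, and $|f^n(a)-f^n(b)|<\varepsilon$, the map $f^n$ sends $[a,b]$ homeomorphically onto $f^n([a,b])$. *)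

theory Defs
  imports "HOL-Analysis.Analysis"
begin

text \<open>
  The unit interval is the set \<open>{0..1}\<close> of reals. A self-map of it is represented by
  a function on all of the reals, whose values outside \<open>{0..1}\<close> are irrelevant: all notions below
  evaluate \<open>f\<close> and its iterates only at points of \<open>{0..1}\<close>.
\<close>

definition interval_map :: "(real \<Rightarrow> real) \<Rightarrow> bool" where
  "interval_map f \<longleftrightarrow> continuous_on {0..1} f \<and> f ` {0..1} = {0..1}"

text \<open>Neighbourhoods of a critical point are open relative to the domain \<open>{0..1}\<close> of the map.\<close>

definition critical_point :: "(real \<Rightarrow> real) \<Rightarrow> real \<Rightarrow> bool" where
  "critical_point f c \<longleftrightarrow>
     c \<in> {0<..<1} \<and> (\<forall>J. openin (top_of_set {0..1}) J \<and> c \<in> J \<longrightarrow> \<not> inj_on f J)"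

definition piecewise_monotone :: "(real \<Rightarrow> real) \<Rightarrow> bool" where
  "piecewise_monotone f \<longleftrightarrow> finite {c. critical_point f c}"

definition locally_eventually_onto :: "(real \<Rightarrow> real) \<Rightarrow> bool" where
  "locally_eventually_onto f \<longleftrightarrow>
     (\<forall>a b. a < b \<and> {a..b} \<subseteq> {0..1} \<longrightarrow> (\<exists>n\<ge>1. (f ^^ n) ` {a..b} = {0..1}))"

text \<open>
  In the next definition the interval \<open>{u..v}\<close> is empty when \<open>v < u\<close>, so exactly the two
  possible orderings of the images of the endpoints are covered by the disjunction.
\<close>

definition long_zigzag :: "(real \<Rightarrow> real) \<Rightarrow> bool" where
  "long_zigzag f \<longleftrightarrow>
     (\<exists>\<epsilon>>0. \<forall>n a b.
        a \<le> b \<and> {a..b} \<subseteq> {0..1} \<and>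
        ((f ^^ n) ` {a..b} = {(f ^^ n) a..(f ^^ n) b} \<or>
         (f ^^ n) ` {a..b} = {(f ^^ n) b..(f ^^ n) a}) \<and>
        (\<forall>x\<in>{a<..<b}. (f ^^ n) x \<notin> {(f ^^ n) a, (f ^^ n) b}) \<and>
        \<bar>(f ^^ n) a - (f ^^ n) b\<bar> < \<epsilon>
        \<longrightarrow> (\<exists>g. homeomorphism {a..b} ((f ^^ n) ` {a..b}) (f ^^ n) g))"

end

theory Submission
  imports Defs
begin

text \<open>
  The idea is to watch an interval \<open>{a..b}\<close> with extremal endpoints along its orbit, up to the first
  time at which injectivity is lost. Two facts control this moment.

  Local eventual onto-ness prevents long intervals from ever becoming short: for each \<open>\<delta>\<close> there is
  an \<open>\<epsilon>\<close> such that all iterates spread out an interval of length \<open>\<delta>\<close> by at least \<open>\<epsilon>\<close>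
  (\<open>long_intervals_stay_long\<close>). So if the image under \<open>f ^^ n\<close> is shorter than \<open>\<epsilon>\<close>, then all earlier
  images of \<open>{a..b}\<close> are shorter than \<open>\<delta>\<close>.

  Choose \<open>\<delta>\<close> as a separation constant of the finite set of critical points. An interval \<open>{p..q}\<close>
  shorter than \<open>\<delta>\<close> meets this set at most once, so that \<open>f\<close> is either injective on it or makes a
  single fold there. A fold repeats the value of one of the endpoints at another point
  of the interval (\<open>fold_repeats_endpoint_value\<close>). Later iterates preserve this
  coincidence, and so the value of \<open>f ^^ n\<close> at \<open>a\<close> or at \<open>b\<close> would be taken a second time in
  \<open>{a..b}\<close>, which the hypotheses on the endpoints exclude. Hence injectivity is never lost up to
  time \<open>n\<close>, and a continuous injection of a compact interval is a homeomorphism onto its image.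
\<close>

section \<open>Iterates of an interval map\<close>

lemma funpow_image_interval_map:
  assumes "interval_map f"
  shows "(f ^^ n) ` {0..1} = {0..1}"
proof (induction n)
  case (Suc n)
  then show ?case
    using assms by (simp only: funpow.simps image_comp [symmetric] interval_map_def)
qed simp

lemma continuous_on_funpow_interval_map:
  assumes "interval_map f"
  shows "continuous_on {0..1} (f ^^ n)"
proof (induction n)
  case (Suc n)
  then show ?case
    using assms funpow_image_interval_map[OF assms, of n]
    unfolding funpow.simps by (metis continuous_on_compose interval_map_def)
qed simp

lemma funpow_diff_apply:
  assumes "m \<le> n"
  shows "(f ^^ n) x = (f ^^ (n - m)) ((f ^^ m) x)"
  using assms by (metis comp_apply funpow_add le_add_diff_inverse2)

section \<open>Folds\<close>

text \<open>
  If two points had the same value, there would be an extremum strictly between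
  them. Near a non-critical point, however, a continuous function is strictly monotone.
\<close>

lemma inj_on_if_no_critical_point:
  assumes cont: "continuous_on {0..1} f"
    and sub: "{p..q} \<subseteq> {0..1}"
    and nocrit: "\<And>c. c \<in> {p<..<q} \<Longrightarrow> \<not> critical_point f c"
  shows "inj_on f {p..q}"
proof (rule linorder_inj_onI')
  fix x y assume xy: "x \<in> {p..q}" "y \<in> {p..q}" "x < y"
  have sub': "{x..y} \<subseteq> {0..1}" using xy sub by auto
  then have cxy: "continuous_on {x..y} f" using cont continuous_on_subset by blast
  have no_extremum: False
    if z: "x < z" "z < y" and ext: "(\<forall>w\<in>{x..y}. f w \<le> f z) \<or> (\<forall>w\<in>{x..y}. f z \<le> f w)" for z
  proof -
    have z01: "z \<in> {0<..<1}" "z \<in> {p<..<q}" using z xy sub' by auto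
    then obtain J where J: "openin (top_of_set {0..1}) J" "z \<in> J" "inj_on f J"
      using nocrit[of z] unfolding critical_point_def by blast
    then obtain U where U: "open U" "J = {0..1} \<inter> U" by (auto simp: openin_open)
    then obtain e where e: "e > 0" "cball z e \<subseteq> U"
      using J by (meson IntD2 open_contains_cball)
    define d where "d = min e (min (z - x) (y - z))"
    have d: "d > 0" "x \<le> z - d" "z + d \<le> y" "d \<le> e" using e z by (auto simp: d_def)
    have "{z-d..z+d} \<subseteq> cball z e" using d by (auto simp: dist_real_def)
    moreover have "{z-d..z+d} \<subseteq> {x..y}" using d by auto
    ultimately have dJ: "{z-d..z+d} \<subseteq> J" "{z-d..z+d} \<subseteq> {x..y}" using e U sub' by blast+
    have "f (z-d) < f z \<and> f z < f (z+d) \<or> f (z+d) < f z \<and> f z < f (z-d)"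
      using d dJ J(3) cxy by (intro continuous_inj_imp_mono)
        (auto intro: continuous_on_subset inj_on_subset)
    moreover have "z - d \<in> {x..y}" "z + d \<in> {x..y}" using d z by auto
    ultimately show False using ext by force
  qed
  show "f x \<noteq> f y"
  proof
    assume eq: "f x = f y"
    obtain M where M: "M \<in> {x..y}" "\<forall>w\<in>{x..y}. f w \<le> f M"
      using continuous_attains_sup[of "{x..y}" f] cxy xy by auto
    obtain m where m: "m \<in> {x..y}" "\<forall>w\<in>{x..y}. f m \<le> f w"
      using continuous_attains_inf[of "{x..y}" f] cxy xy by auto
    have M': "M = x \<or> M = y" using no_extremum[of M] M by force
    have m': "m = x \<or> m = y" using no_extremum[of m] m by force
    \<comment> \<open>Both extrema equal the common value at the ends, so \<open>f\<close> is constant and the midpoint will do.\<close>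
    have "\<forall>w\<in>{x..y}. f w \<le> f x" using M M' eq by auto
    moreover have "(x + y) / 2 \<in> {x..y}" using xy by auto
    ultimately have "\<forall>w\<in>{x..y}. f w \<le> f ((x + y) / 2)"
      using m m' eq by (metis order_trans)
    then show False using no_extremum[of "(x + y) / 2"] xy by auto
  qed
qed

text \<open>
  Here \<open>f\<close> folds upwards at \<open>c\<close>. The higher one of the two ends of the graph lies on a
  level that the other branch crosses as well.
\<close>

lemma peak_repeats_endpoint_value:
  fixes f :: "real \<Rightarrow> real"
  assumes cont: "continuous_on {p..q} f" and c: "p < c" "c < q" and peak: "f p < f c" "f q < f c"
  shows "f p = f q \<or> (\<exists>x\<in>{p<..<q}. f x \<in> {f p, f q})"
proof (cases "f p \<le> f q")
  case True
  have "continuous_on {p..c} f" using cont c by (auto intro: continuous_on_subset)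
  then obtain z where "p \<le> z" "z \<le> c" "f z = f q"
    using IVT'[of f p "f q" c] True c peak by auto
  then show ?thesis using c by (cases "z = p") auto
next
  case False
  have "continuous_on {c..q} f" using cont c by (auto intro: continuous_on_subset)
  then obtain z where "c \<le> z" "z \<le> q" "f z = f p"
    using IVT2'[of f q "f p" c] False c peak by auto
  then show ?thesis using c False by (cases "z = q") auto
qed

text \<open>
  Since \<open>f\<close> is strictly monotone on either side of \<open>c\<close>, a coincidence of values across \<open>c\<close>
  forces both endpoint values to lie on the same side of \<open>f c\<close>, so that the graph of \<open>f\<close> or of
  \<open>- f\<close> has a peak.
\<close>

lemma fold_repeats_endpoint_value:
  fixes f :: "real \<Rightarrow> real"
  assumes cont: "continuous_on {p..q} f" and c: "p < c" "c < q"
    and inj: "inj_on f {p..c}" "inj_on f {c..q}" and noninj: "\<not> inj_on f {p..q}"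
  shows "f p = f q \<or> (\<exists>x\<in>{p<..<q}. f x \<in> {f p, f q})"
proof -
  obtain x y where xy: "x \<in> {p..q}" "y \<in> {p..q}" "x < y" "f x = f y"
    using noninj by (meson linorder_inj_onI')
  have xc: "x < c" using inj_onD[OF inj(2), of x y] xy by force
  have yc: "c < y" using inj_onD[OF inj(1), of x y] xy by force
  have contp: "continuous_on {p..c} f" and contq: "continuous_on {c..q} f"
    using cont c by (auto intro: continuous_on_subset)
  have left: "x = p \<or> (f p < f x \<and> f x < f c) \<or> (f c < f x \<and> f x < f p)"
    using continuous_inj_imp_mono[of p x c f] xc contp inj xy by fastforce
  have right: "y = q \<or> (f c < f y \<and> f y < f q) \<or> (f q < f y \<and> f y < f c)"
    using continuous_inj_imp_mono[of c y q f] yc contq inj xy by fastforce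
  have "f x \<noteq> f c" using inj_onD[OF inj(1), of x c] xc xy(1) by force
  then have "(f p < f c \<and> f q < f c) \<or> (- f p < - f c \<and> - f q < - f c)"
    using left right xy(4) by auto
  then show ?thesis
  proof
    assume "f p < f c \<and> f q < f c"
    then show ?thesis using peak_repeats_endpoint_value[of p q f c] cont c by blast
  next
    assume "- f p < - f c \<and> - f q < - f c"
    then show ?thesis
      using peak_repeats_endpoint_value[of p q "\<lambda>x. - f x" c] cont c
      by (auto intro: continuous_on_minus)
  qed
qed

lemma finite_set_separated:
  fixes S :: "real set"
  assumes "finite S"
  obtains d where "d > 0" "\<And>x y. x \<in> S \<Longrightarrow> y \<in> S \<Longrightarrow> x \<noteq> y \<Longrightarrow> d \<le> \<bar>x - y\<bar>"
proof -
  define D where "D = insert 1 ((\<lambda>(x, y). \<bar>x - y\<bar>) ` (S \<times> S) - {0})"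
  have "finite D" using assms by (auto simp: D_def)
  moreover have "\<forall>d\<in>D. d > 0" by (auto simp: D_def)
  ultimately have "Min D > 0" by (simp add: D_def)
  moreover have "Min D \<le> \<bar>x - y\<bar>" if "x \<in> S" "y \<in> S" "x \<noteq> y" for x y
    using that \<open>finite D\<close> by (intro Min_le) (force simp: D_def)+
  ultimately show ?thesis using that by blast
qed

lemma short_interval_inj_or_repeats_endpoint_value:
  assumes "continuous_on {0..1} f" "piecewise_monotone f"
  obtains d where "d > 0"
    "\<And>p q. {p..q} \<subseteq> {0..1} \<Longrightarrow> q - p < d \<Longrightarrow>
       inj_on f {p..q} \<or> f p = f q \<or> (\<exists>x\<in>{p<..<q}. f x \<in> {f p, f q})"
proof -
  obtain d where d: "d > 0"
    "\<And>x y. critical_point f x \<Longrightarrow> critical_point f y \<Longrightarrow> x \<noteq> y \<Longrightarrow> d \<le> \<bar>x - y\<bar>"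
    using finite_set_separated[of "{c. critical_point f c}"] assms(2)
    unfolding piecewise_monotone_def by auto
  have "inj_on f {p..q} \<or> f p = f q \<or> (\<exists>x\<in>{p<..<q}. f x \<in> {f p, f q})"
    if pq: "{p..q} \<subseteq> {0..1}" "q - p < d" for p q
  proof (cases "\<exists>c\<in>{p<..<q}. critical_point f c")
    case False
    then show ?thesis using inj_on_if_no_critical_point[OF assms(1) pq(1)] by blast
  next
    case True
    then obtain c where c: "p < c" "c < q" "critical_point f c" by auto
    have only: "\<not> critical_point f x" if "x \<in> {p<..<q}" "x \<noteq> c" for x
      using d(2)[of x c] that c pq(2) by auto
    have "inj_on f {p..c}" "inj_on f {c..q}"
      using c pq(1) only by (intro inj_on_if_no_critical_point[OF assms(1)]; force)+
    moreover have "continuous_on {p..q} f" using assms(1) pq(1) continuous_on_subset by blast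
    ultimately show ?thesis using fold_repeats_endpoint_value[of p q f c] c by blast
  qed
  then show ?thesis using that d(1) by blast
qed

section \<open>Long intervals stay long\<close>

lemma iterates_spread_interval:
  assumes f: "interval_map f" "locally_eventually_onto f"
    and ab: "a < b" "{a..b} \<subseteq> {0..1}"
  shows "\<exists>e>0. \<forall>n. \<exists>x\<in>{a..b}. \<exists>y\<in>{a..b}. e \<le> \<bar>(f ^^ n) x - (f ^^ n) y\<bar>"
proof -
  obtain N where N: "(f ^^ N) ` {a..b} = {0..1}"
    using f(2) ab unfolding locally_eventually_onto_def by metis
  then have "0 \<in> (f ^^ N) ` {a..b}" "1 \<in> (f ^^ N) ` {a..b}" by simp_all
  then obtain u v where uv: "u \<in> {a..b}" "v \<in> {a..b}" "(f ^^ N) u = 0" "(f ^^ N) v = 1"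
    by (metis imageE)
  \<comment> \<open>The points \<open>u\<close> and \<open>v\<close> are separated at time \<open>N\<close>, hence at all earlier times; \<open>1\<close> covers
    the later times, at which the image is the whole unit interval.\<close>
  define e where "e = Min (insert 1 ((\<lambda>n. \<bar>(f ^^ n) u - (f ^^ n) v\<bar>) ` {..N}))"
  have "(f ^^ n) u \<noteq> (f ^^ n) v" if "n \<le> N" for n
    using that uv funpow_diff_apply[of n N f] by (metis zero_neq_one)
  then have "e > 0" by (auto simp: e_def)
  moreover have "\<exists>x\<in>{a..b}. \<exists>y\<in>{a..b}. e \<le> \<bar>(f ^^ n) x - (f ^^ n) y\<bar>" for n
  proof (cases "n \<le> N")
    case True
    then have "e \<le> \<bar>(f ^^ n) u - (f ^^ n) v\<bar>" unfolding e_def by (intro Min_le) auto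
    then show ?thesis using uv by blast
  next
    case False
    then have "f ^^ n = (f ^^ (n - N)) \<circ> (f ^^ N)"
      using funpow_add[of "n - N" N f] by simp
    then have "(f ^^ n) ` {a..b} = {0..1}"
      using N funpow_image_interval_map[OF f(1), of "n - N"] by (simp only: image_comp [symmetric])
    then have "0 \<in> (f ^^ n) ` {a..b}" "1 \<in> (f ^^ n) ` {a..b}" by simp_all
    then obtain x y where "x \<in> {a..b}" "y \<in> {a..b}" "(f ^^ n) x = 0" "(f ^^ n) y = 1"
      by (metis imageE)
    moreover have "e \<le> 1" unfolding e_def by (intro Min_le) auto
    ultimately show ?thesis by force
  qed
  ultimately show ?thesis by blast
qed

text \<open>
  To make the spread uniform over all intervals of length \<open>d\<close>, cut the unit interval into equal cells
  of length at most \<open>d / 2\<close>: each such interval contains one of these finitely many cells.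
\<close>

lemma long_intervals_stay_long:
  assumes f: "interval_map f" "locally_eventually_onto f" and d: "d > 0"
  obtains e where "e > 0"
    "\<And>n a b. {a..b} \<subseteq> {0..1} \<Longrightarrow> d \<le> b - a \<Longrightarrow>
       \<exists>x\<in>{a..b}. \<exists>y\<in>{a..b}. e \<le> \<bar>(f ^^ n) x - (f ^^ n) y\<bar>"
proof -
  obtain N :: nat where N: "2 / d < real N" using reals_Archimedean2 by blast
  have N0: "real N > 0" using N d by (meson divide_pos_pos less_trans zero_less_numeral)
  define cell where "cell i = {real i / real N .. (real i + 1) / real N}" for i
  have "\<exists>e>0. \<forall>n. \<exists>x\<in>cell i. \<exists>y\<in>cell i. e \<le> \<bar>(f ^^ n) x - (f ^^ n) y\<bar>" if "i < N" for i
    unfolding cell_def using that N0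
    by (intro iterates_spread_interval f) (auto simp: field_simps)
  then obtain E where E: "\<And>i. i < N \<Longrightarrow> E i > 0"
    "\<And>i n. i < N \<Longrightarrow> \<exists>x\<in>cell i. \<exists>y\<in>cell i. E i \<le> \<bar>(f ^^ n) x - (f ^^ n) y\<bar>"
    by metis
  define e where "e = Min (insert 1 (E ` {..<N}))"
  have "e > 0" using E(1) by (auto simp: e_def)
  moreover have "\<exists>x\<in>{a..b}. \<exists>y\<in>{a..b}. e \<le> \<bar>(f ^^ n) x - (f ^^ n) y\<bar>"
    if ab: "{a..b} \<subseteq> {0..1}" "d \<le> b - a" for n a b
  proof -
    have a: "0 \<le> a" "b \<le> 1" using ab d by auto
    define i where "i = nat \<lceil>a * N\<rceil>"
    have i: "a * N \<le> real i" "real i < a * N + 1"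
      using a N0 unfolding i_def by (auto simp: of_nat_nat) linarith
    have "2 < d * N" using N d by (simp add: field_simps)
    also have "d * N \<le> (b - a) * N" using ab(2) N0 by (simp add: mult_right_mono)
    finally have bN: "real i + 1 < b * N" using i by (simp add: algebra_simps)
    also have "b * N \<le> N" using a N0 by simp
    finally have "i < N" by simp
    have "cell i \<subseteq> {a..b}" unfolding cell_def using i bN N0 by (auto simp: field_simps)
    moreover have "e \<le> E i" unfolding e_def using \<open>i < N\<close> by (intro Min_le) auto
    ultimately show ?thesis using E(2)[OF \<open>i < N\<close>, of n] by (meson order_trans subsetD)
  qed
  ultimately show ?thesis using that by blast
qed

section \<open>The long-zigzag property\<close>

lemma continuous_inj_image_interval:
  fixes g :: "real \<Rightarrow> real"
  assumes "a \<le> b" "continuous_on {a..b} g" "inj_on g {a..b}"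
  shows "g ` {a..b} = {min (g a) (g b)..max (g a) (g b)}"
proof
  have "g x \<in> {min (g a) (g b)..max (g a) (g b)}" if "x \<in> {a..b}" for x
    using continuous_inj_imp_mono[of a x b g] assms that by fastforce
  then show "g ` {a..b} \<subseteq> {min (g a) (g b)..max (g a) (g b)}" by blast
  have "connected (g ` {a..b})" using assms(2) by (simp add: connected_continuous_image)
  moreover have "min (g a) (g b) \<in> g ` {a..b}" "max (g a) (g b) \<in> g ` {a..b}"
    using assms(1) by (auto simp: min_def max_def)
  ultimately show "{min (g a) (g b)..max (g a) (g b)} \<subseteq> g ` {a..b}"
    by (simp add: connected_contains_Icc)
qed

theorem corollary3p8:
  fixes f :: "real \<Rightarrow> real"
  assumes "interval_map f"
    and "piecewise_monotone f"
    and "locally_eventually_onto f"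
  shows "long_zigzag f"
proof -
  have contf: "continuous_on {0..1} f" using assms(1) by (simp add: interval_map_def)
  obtain d where d: "d > 0"
    "\<And>p q. {p..q} \<subseteq> {0..1} \<Longrightarrow> q - p < d \<Longrightarrow>
       inj_on f {p..q} \<or> f p = f q \<or> (\<exists>x\<in>{p<..<q}. f x \<in> {f p, f q})"
    using short_interval_inj_or_repeats_endpoint_value[OF contf assms(2)] by metis
  obtain e where e: "e > 0"
    "\<And>n a b. {a..b} \<subseteq> {0..1} \<Longrightarrow> d \<le> b - a \<Longrightarrow>
       \<exists>x\<in>{a..b}. \<exists>y\<in>{a..b}. e \<le> \<bar>(f ^^ n) x - (f ^^ n) y\<bar>"
    using long_intervals_stay_long[OF assms(1,3) d(1)] by metis
  have "\<exists>g. homeomorphism {a..b} ((f ^^ n) ` {a..b}) (f ^^ n) g"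
    if ab: "a \<le> b" "{a..b} \<subseteq> {0..1}"
      and img: "(f ^^ n) ` {a..b} = {(f ^^ n) a..(f ^^ n) b} \<or>
         (f ^^ n) ` {a..b} = {(f ^^ n) b..(f ^^ n) a}"
      and ends: "\<forall>x\<in>{a<..<b}. (f ^^ n) x \<notin> {(f ^^ n) a, (f ^^ n) b}"
      and short: "\<bar>(f ^^ n) a - (f ^^ n) b\<bar> < e" for n a b
  proof -
    have cont: "continuous_on {a..b} (f ^^ i)" for i
      using continuous_on_funpow_interval_map[OF assms(1)] ab(2) continuous_on_subset by blast
    have "(f ^^ n) b - (f ^^ n) a < e" "(f ^^ n) a - (f ^^ n) b < e" using short by linarith+
    then obtain l r where lr: "(f ^^ n) ` {a..b} = {l..r}" "r - l < e" using img by blast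
    have "inj_on (f ^^ i) {a..b}" if "i \<le> n" for i
      using that
    proof (induction i)
      case (Suc i)
      define h where "h = f ^^ i"
      define p where "p = min (h a) (h b)"
      define q where "q = max (h a) (h b)"
      have inj: "inj_on h {a..b}" using Suc by (simp add: h_def)
      have K: "h ` {a..b} = {p..q}" unfolding p_def q_def
        using continuous_inj_image_interval ab(1) cont inj by (auto simp: h_def)
      have K01: "{p..q} \<subseteq> {0..1}"
        using funpow_image_interval_map[OF assms(1), of i] ab(2) K unfolding h_def by blast
      have later: "(f ^^ n) x = (f ^^ (n - i)) (h x)" "(f ^^ n) x = (f ^^ (n - Suc i)) (f (h x))" for x
        using funpow_diff_apply[of i n f x] funpow_diff_apply[of "Suc i" n f x] Suc.prems
        by (auto simp: h_def)
      have "q - p < d"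
      proof (rule ccontr)
        assume "\<not> q - p < d"
        then obtain x y where "x \<in> {a..b}" "y \<in> {a..b}" "e \<le> \<bar>(f ^^ n) x - (f ^^ n) y\<bar>"
          using e(2)[OF K01, of "n - i"] unfolding K[symmetric] by (auto simp: later(1))
        moreover from this have "(f ^^ n) x \<in> {l..r}" "(f ^^ n) y \<in> {l..r}"
          using lr(1) by blast+
        ultimately show False using lr(2) by auto
      qed
      then have "inj_on f {p..q} \<or> f p = f q \<or> (\<exists>x\<in>{p<..<q}. f x \<in> {f p, f q})"
        using d(2) K01 by blast
      moreover have "f p = f q \<Longrightarrow> inj_on f {p..q}"
      proof -
        assume "f p = f q"
        then have "f (h a) = f (h b)" by (auto simp: p_def q_def min_def max_def split: if_splits)
        then have eq: "(f ^^ n) a = (f ^^ n) b" by (simp add: later(2))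
        \<comment> \<open>The image is then a single point, so an interior point of \<open>{a..b}\<close> would repeat it.\<close>
        have "\<not> a < b"
        proof
          assume "a < b"
          then have "(f ^^ n) ((a + b) / 2) \<in> (f ^^ n) ` {a..b}" by auto
          then show False using ends \<open>a < b\<close> img eq by (auto dest!: bspec[of _ _ "(a + b) / 2"])
        qed
        then show ?thesis using ab(1) by (simp add: p_def q_def)
      qed
      moreover have False if x: "x \<in> {p<..<q}" "f x \<in> {f p, f q}" for x
      proof -
        have "x \<in> h ` {a..b}" unfolding K using x(1) by simp
        then obtain z where z: "z \<in> {a..b}" "x = h z" by (metis imageE)
        have "z \<noteq> a" "z \<noteq> b" using x(1) z(2) by (auto simp: p_def q_def)
        then have "z \<in> {a<..<b}" using z by auto
        moreover have "f (h z) \<in> {f (h a), f (h b)}"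
          using x(2) z(2) by (auto simp: p_def q_def min_def max_def split: if_splits)
        then have "(f ^^ n) z \<in> {(f ^^ n) a, (f ^^ n) b}" by (auto simp: later(2))
        ultimately show False using ends by blast
      qed
      ultimately have "inj_on f (h ` {a..b})" unfolding K by blast
      then show ?case using inj unfolding h_def funpow.simps by (intro comp_inj_on)
    qed simp
    then show ?thesis using homeomorphism_compact[OF _ cont refl] by blast
  qed
  then show ?thesis unfolding long_zigzag_def using e(1) by blast
qed

end
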